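(* For any partition $\lambda$ of a positive integer $n$, $\mathcal{O}(\lambda)\equiv\mathcal{O}(\lambda')\pmod 4$ if and only if $\lambda$ has an even number of even hooks.
   Context: For a partition $\lambda$, $\lambda'$ denotes its conjugate partition and $\mathcal{O}(\lambda)$ denotes the number of odd parts of $\lambda$. For a cell $(i,j)$ of the Young diagram of $\lambda$, its hook length is $\lambda_i-j+\lambda'_j-i+1$. An even hook is a cell of the Young diagram whose hook length is even; the number of even hooks of $\lambda$ is the number of such cells. *)

theory Defs
  imports "HOL-Number_Theory.Cong"
begin

text \<open>A partition is the list of its parts, all positive and in weakly decreasing order.\<close>

definition is_partition_of :: "nat list \<Rightarrow> nat \<Rightarrow> bool" where
  "is_partition_of lam n \<longleftrightarrow>
     sorted_wrt (\<ge>) lam \<and> (\<forall>p\<in>set lam. 0 < p) \<and> sum_list lam = n"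

text \<open>Parts are indexed from \<open>1\<close>, and \<open>part lam i = 0\<close> beyond the last part.\<close>

definition part :: "nat list \<Rightarrow> nat \<Rightarrow> nat" where
  "part lam i = (if 1 \<le> i \<and> i \<le> length lam then lam ! (i - 1) else 0)"

definition young_diagram :: "nat list \<Rightarrow> (nat \<times> nat) set" where
  "young_diagram lam = {(i, j). 1 \<le> i \<and> i \<le> length lam \<and> 1 \<le> j \<and> j \<le> part lam i}"

text \<open>The \<open>j\<close>-th part of the conjugate is the length of column \<open>j\<close> of the Young diagram;
  the number of nonempty columns is the first part.\<close>

definition conjugate :: "nat list \<Rightarrow> nat list" where
  "conjugate lam = map (\<lambda>j. card {i. (i, j) \<in> young_diagram lam}) [1..<part lam 1 + 1]"

definition odd_parts :: "nat list \<Rightarrow> nat" where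
  "odd_parts lam = length (filter odd lam)"

text \<open>On a cell of the Young diagram of a partition neither of the subtractions truncates.\<close>

definition hook_length :: "nat list \<Rightarrow> nat \<times> nat \<Rightarrow> nat" where
  "hook_length lam = (\<lambda>(i, j). (part lam i - j) + (part (conjugate lam) j - i) + 1)"

definition even_hooks :: "nat list \<Rightarrow> (nat \<times> nat) set" where
  "even_hooks lam = {c \<in> young_diagram lam. even (hook_length lam c)}"

end

(* Induct on the number of rows, removing the first row a of the diagram. If c_j is the length of
   column j of what remains, the first row has the hooks a - j + c_j + 1 for 1 <= j <= a, and modulo 2
   the number of even ones is the number of odd a - j plus the number of odd c_j. Restoring the row
   makes exactly the odd columns even, so O(lam') is replaced by a - O(lam'). Together these give
   O(lam) = O(lam') + 2 E (mod 4), where E is the number of even hooks. *)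
theory Submission
  imports Defs
begin

text \<open>Counting parts instead of cells makes adding a row a one-step recursion on the
  list.\<close>

definition column :: "nat list \<Rightarrow> nat \<Rightarrow> nat" where
  "column lam j = length (filter ((\<le>) j) lam)"

lemma column_Nil [simp]: "column [] j = 0"
  by (simp add: column_def)

lemma column_Cons: "column (a # lam) j = (if j \<le> a then Suc (column lam j) else column lam j)"
  by (simp add: column_def)

lemma column_eq_0: "\<forall>p\<in>set lam. p < j \<Longrightarrow> column lam j = 0"
  by (force simp: column_def filter_empty_conv)

lemma card_young_diagram_column:
  assumes "1 \<le> j"
  shows "card {i. (i, j) \<in> young_diagram lam} = column lam j"
proof -
  \<comment> \<open>\<open>Suc\<close> converts list positions, which start at 0, into row numbers,
    which start at 1.\<close>
  have "(i, j) \<in> young_diagram lam \<longleftrightarrow> i \<in> Suc ` {i. i < length lam \<and> j \<le> lam ! i}" for i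
    using assms by (cases i) (auto simp: young_diagram_def part_def)
  then have "{i. (i, j) \<in> young_diagram lam} = Suc ` {i. i < length lam \<and> j \<le> lam ! i}"
    by blast
  then show ?thesis
    by (simp add: card_image column_def length_filter_conv_card)
qed

lemma le_part_1: "sorted_wrt (\<ge>) lam \<Longrightarrow> p \<in> set lam \<Longrightarrow> p \<le> part lam 1"
  by (cases lam) (auto simp: part_def)

lemma conjugate_eq: "conjugate lam = map (column lam) [1..<part lam 1 + 1]"
  unfolding conjugate_def by (intro map_cong) (auto simp: card_young_diagram_column)

lemma part_conjugate:
  assumes "sorted_wrt (\<ge>) lam" "1 \<le> j"
  shows "part (conjugate lam) j = column lam j"
proof (cases "j \<le> part lam 1")
  case True
  then show ?thesis
    using assms(2) by (simp add: conjugate_eq part_def[of "map _ _"] del: upt_Suc)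
next
  case False
  \<comment> \<open>Past the last column \<open>part\<close> defaults to 0, and no part reaches
    \<open>j\<close> because the first part is the largest.\<close>
  then have "column lam j = 0"
    using le_part_1[OF assms(1)] by (intro column_eq_0) force
  then show ?thesis
    using False by (simp add: conjugate_eq part_def[of "map _ _"] del: upt_Suc)
qed

text \<open>Columns beyond the first part have length 0, which is even, so the count may run up to
  any larger \<open>a\<close>. This lets \<open>lam\<close> and \<open>a # lam\<close> be compared
  over the same range.\<close>

lemma odd_parts_conjugate:
  assumes "sorted_wrt (\<ge>) lam" "part lam 1 \<le> a"
  shows "odd_parts (conjugate lam) = card {j \<in> {1..a}. odd (column lam j)}"
proof -
  have "odd_parts (conjugate lam) = length (filter (odd \<circ> column lam) [1..<part lam 1 + 1])"
    by (simp add: odd_parts_def conjugate_eq filter_map del: upt_Suc)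
  also have "\<dots> = card (set (filter (odd \<circ> column lam) [1..<part lam 1 + 1]))"
    by (rule distinct_card[symmetric]) simp
  also have "set (filter (odd \<circ> column lam) [1..<part lam 1 + 1]) = {j \<in> {1..a}. odd (column lam j)}"
  proof -
    have "j < Suc (part lam 1) \<and> j \<le> a" if "odd (column lam j)" for j
    proof (rule ccontr)
      assume "\<not> (j < Suc (part lam 1) \<and> j \<le> a)"
      then have "\<not> j \<le> part lam 1"
        using assms(2) by linarith
      then have "column lam j = 0"
        using le_part_1[OF assms(1)] by (intro column_eq_0) force
      with that show False by simp
    qed
    then show ?thesis
      by (auto simp del: upt_Suc)
  qed
  finally show ?thesis .
qed

lemma young_diagram_Cons:
  "young_diagram (a # lam) = Pair 1 ` {1..a} \<union> map_prod Suc id ` young_diagram lam"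
proof (intro set_eqI)
  fix c :: "nat \<times> nat"
  obtain i j where c: "c = (i, j)" by (cases c)
  show "c \<in> young_diagram (a # lam) \<longleftrightarrow> c \<in> Pair 1 ` {1..a} \<union> map_prod Suc id ` young_diagram lam"
  \<comment> \<open>Row 0 is empty on both sides, and row 1 comes only from the new row, since rows
    of \<open>young_diagram lam\<close> start at 1.\<close>
  proof (cases "i = 0 \<or> i = 1")
    case True
    then show ?thesis by (auto simp: c young_diagram_def part_def)
  next
    case False
    then obtain k where "i = Suc (Suc k)" by (metis One_nat_def not0_implies_Suc)
    then show ?thesis
      by (auto simp: c young_diagram_def part_def image_iff intro!: exI[of _ "Suc k"])
  qed
qed

lemma finite_young_diagram: "finite (young_diagram lam)"
proof (induction lam)
  case Nil
  have "young_diagram [] = {}" by (auto simp: young_diagram_def)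
  then show ?case by simp
qed (simp add: young_diagram_Cons)

text \<open>The cell that the new row adds to column \<open>j\<close> cancels against the row index
  1, leaving the old column as the leg.\<close>

lemma hook_length_Cons_first:
  assumes "sorted_wrt (\<ge>) (a # lam)" "1 \<le> j" "j \<le> a"
  shows "hook_length (a # lam) (1, j) = (a - j) + column lam j + 1"
proof -
  have "part (a # lam) 1 = a" by (simp add: part_def)
  then show ?thesis
    using assms(3) part_conjugate[OF assms(1,2)] by (simp add: hook_length_def column_Cons)
qed

text \<open>The arm is untouched. In the leg, column length and row index both grow by one, the
  former because sortedness gives \<open>j \<le> a\<close>.\<close>

lemma hook_length_Cons_Suc:
  assumes "sorted_wrt (\<ge>) (a # lam)" "(i, j) \<in> young_diagram lam"
  shows "hook_length (a # lam) (Suc i, j) = hook_length lam (i, j)"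
proof -
  have ij: "1 \<le> i" "i \<le> length lam" "1 \<le> j" "j \<le> lam ! (i - 1)"
    using assms(2) by (auto simp: young_diagram_def part_def)
  then have "lam ! (i - 1) \<in> set lam" by (intro nth_mem) linarith
  then have "j \<le> a" using assms(1) ij(4) by auto
  moreover have "part (a # lam) (Suc i) = part lam i"
    using ij by (simp add: part_def nth_Cons')
  moreover have "part (conjugate lam) j = column lam j"
    using assms(1) ij(3) by (intro part_conjugate) auto
  ultimately show ?thesis
    using part_conjugate[OF assms(1) ij(3)] by (simp add: hook_length_def column_Cons)
qed

lemma card_even_hooks_Cons:
  assumes "sorted_wrt (\<ge>) (a # lam)"
  shows "card (even_hooks (a # lam)) =
    card {j \<in> {1..a}. odd ((a - j) + column lam j)} + card (even_hooks lam)"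
proof -
  let ?R = "{j \<in> {1..a}. odd ((a - j) + column lam j)}"
  have "even_hooks (a # lam) = Pair 1 ` ?R \<union> map_prod Suc id ` even_hooks lam"
    using hook_length_Cons_first[OF assms] hook_length_Cons_Suc[OF assms]
    by (auto simp: even_hooks_def young_diagram_Cons)
  moreover have "Pair 1 ` ?R \<inter> map_prod Suc id ` even_hooks lam = {}"
    by (auto simp: even_hooks_def young_diagram_def)
  moreover have "finite (even_hooks lam)"
    by (simp add: even_hooks_def finite_young_diagram)
  moreover have "card (map_prod Suc id ` even_hooks lam) = card (even_hooks lam)"
    by (intro card_image) (auto simp: inj_on_def)
  moreover have "card (Pair (1::nat) ` ?R) = card ?R"
    by (intro card_image) (auto simp: inj_on_def)
  moreover have "finite (Pair (1::nat) ` ?R)"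
    by simp
  ultimately show ?thesis
    by (simp only: card_Un_disjoint finite_imageI)
qed

text \<open>Reversed, the sum is 0 + ... + (a - 1), which has exactly \<open>a div 2\<close> odd
  terms.\<close>

lemma even_sum_diff: "even (\<Sum>j = 1..a. a - j) \<longleftrightarrow> even (a div 2)" for a :: nat
proof -
  have "(\<Sum>j = 1..a. a - j) = \<Sum>{..<a}"
    by (rule sum.reindex_bij_witness[of _ "\<lambda>k. a - k" "\<lambda>j. a - j"]) auto
  moreover have "even (\<Sum>{..<a}) \<longleftrightarrow> even (a div 2)"
    by (induction a) (simp_all, presburger)
  ultimately show ?thesis by simp
qed

text \<open>The arithmetic of the induction step: \<open>x\<close>, \<open>c\<close> and
  \<open>e\<close> stand for the odd parts, odd columns and even hooks of the smaller partition, and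
  \<open>r\<close> for the even hooks in the new row. The last hypothesis says that
  \<open>r + c + a div 2\<close> is even.\<close>

lemma removal_step_mod_4:
  fixes a c e r x :: nat
  assumes "x mod 4 = (c + 2 * e) mod 4" "c \<le> a" "even r \<longleftrightarrow> (even (a div 2) \<longleftrightarrow> even c)"
  shows "(a mod 2 + x) mod 4 = (a - c + 2 * (r + e)) mod 4"
proof -
  define q s where "q = a div 2" and "s = a mod 2"
  obtain d where d: "a = c + d"
    using assms(2) le_Suc_ex by blast
  have "even (r + c + q)"
    using assms(3) by (auto simp: q_def)
  then obtain k where "r + c + q = 2 * k"
    by blast
  moreover have "2 * q + s = c + d"
    using d by (metis mult_div_mod_eq q_def s_def)
  \<comment> \<open>Replace \<open>4 * k\<close> by \<open>2 * (r + c + q)\<close> and then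
    \<open>2 * q + s\<close> by \<open>c + d\<close>. The multiples of 4 on both sides avoid
    subtraction and vanish modulo 4.\<close>
  ultimately have "s + c + 2 * e + k * 4 = d + 2 * (r + e) + c * 4"
    by presburger
  then have "(s + c + 2 * e) mod 4 = (d + 2 * (r + e)) mod 4"
    by (metis mod_mult_self1)
  moreover have "(s + c + 2 * e) mod 4 = (s + x) mod 4"
    using assms(1) by (metis add.assoc mod_add_right_eq)
  ultimately show ?thesis
    using d by (simp add: s_def)
qed

lemma odd_parts_cong_conjugate:
  assumes "sorted_wrt (\<ge>) lam"
  shows "[odd_parts lam = odd_parts (conjugate lam) + 2 * card (even_hooks lam)] (mod 4)"
  using assms
proof (induction lam)
  case Nil
  have "even_hooks [] = {}"
    by (auto simp: even_hooks_def young_diagram_def)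
  then show ?case
    by (simp add: odd_parts_def conjugate_eq part_def)
next
  case (Cons a lam)
  let ?C = "{j \<in> {1..a}. odd (column lam j)}"
  let ?R = "{j \<in> {1..a}. odd ((a - j) + column lam j)}"
  have sorted: "sorted_wrt (\<ge>) lam" and "part lam 1 \<le> a"
    using Cons.prems by (cases lam; auto simp: part_def)+
  then have C: "odd_parts (conjugate lam) = card ?C"
    by (rule odd_parts_conjugate)
  have "odd_parts (conjugate (a # lam)) = card {j \<in> {1..a}. odd (column (a # lam) j)}"
    using Cons.prems by (intro odd_parts_conjugate) (auto simp: part_def)
  also have "{j \<in> {1..a}. odd (column (a # lam) j)} = {1..a} - ?C"
    by (auto simp: column_Cons)
  also have "card \<dots> = a - card ?C"
    by (subst card_Diff_subset) auto
  finally have C': "odd_parts (conjugate (a # lam)) = a - card ?C" .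
  have le: "card ?C \<le> a"
    by (rule order_trans[OF card_mono[of "{1..a}"]]) auto
  \<comment> \<open>A sum has the parity of its number of odd terms. Passing to sums separates the
    arms from the columns, and passing back counts the odd columns.\<close>
  have "even (card ?R) \<longleftrightarrow> even (\<Sum>j = 1..a. (a - j) + column lam j)"
    by (simp only: even_sum_iff finite_atLeastAtMost)
  also have "\<dots> \<longleftrightarrow> (even (\<Sum>j = 1..a. a - j) \<longleftrightarrow> even (\<Sum>j = 1..a. column lam j))"
    by (simp only: sum.distrib even_add)
  also have "\<dots> \<longleftrightarrow> (even (a div 2) \<longleftrightarrow> even (card ?C))"
    by (simp only: even_sum_diff even_sum_iff finite_atLeastAtMost)
  finally have R: "even (card ?R) \<longleftrightarrow> (even (a div 2) \<longleftrightarrow> even (card ?C))" .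
  have "odd_parts (a # lam) = a mod 2 + odd_parts lam"
    by (simp add: odd_parts_def odd_iff_mod_2_eq_one)
  then show ?case
    using removal_step_mod_4[OF _ le R] Cons.IH[OF sorted]
    by (simp only: cong_def C C' card_even_hooks_Cons[OF Cons.prems])
qed

theorem theorem3p1:
  fixes n :: nat and lam :: "nat list"
  assumes "0 < n" and "is_partition_of lam n"
  shows "[odd_parts lam = odd_parts (conjugate lam)] (mod 4) \<longleftrightarrow> even (card (even_hooks lam))"
proof -
  have "[odd_parts lam = odd_parts (conjugate lam) + 2 * card (even_hooks lam)] (mod 4)"
    using assms(2) by (intro odd_parts_cong_conjugate) (simp add: is_partition_of_def)
  \<comment> \<open>After cancelling \<open>x\<close>, 4 divides \<open>2 * k\<close> exactly when 2
    divides \<open>k\<close>.\<close>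
  moreover have "[x + 2 * k = x] (mod 4) \<longleftrightarrow> even k" for x k :: nat
    by (simp add: cong_add_lcancel_0_nat cong_0_iff)
  ultimately show ?thesis
    by (metis cong_sym cong_trans)
qed

end
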